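(* Let $ABC$ be a triangle with circumcircle $\Omega$, let $P$ be a point with isogonal conjugate $P'$ with respect to $ABC$, and let $D$ be the intersection of $\Omega$ with the conic $(ABCPP')$ other than $A,B,C$. Let $X$ be the second intersection of line $DP$ with $\Omega$ and $Y$ the second intersection of line $DP'$ with $\Omega$. Let the circle $(PXY)$ meet line $PP'$ again at $Z$. (a) The circle $(PXY)$ and the conic $(ABCPZ)$ are tangent at $P$ and at $Z$. (b) Let the circle $(PXY)$ meet the conic $(ABCPX)$ at the points $Z_1, Z_2$ (other than $P, X$). Let lines $XZ_1, XZ_2$ meet $\Omega$ again at $Z_1', Z_2'$ respectively. Then line $Z_1'Z_2'$ is tangent to the conic $(ABCPP')$ at $P'$.
   Context: For points $X,Y,Z$, $(XYZ)$ denotes the circle through them; for five points $V,W,X,Y,Z$, $(VWXYZ)$ denotes the conic through them. *)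

theory Defs
  imports "HOL-Analysis.Analysis"
begin

text \<open>Points of the real plane are complex numbers.  A conic (or circle) is given by the
coefficients (a,b,c,d,e,f) of  a x^2 + b x y + c y^2 + d x + e y + f = 0.\<close>

type_synonym conic = "real \<times> real \<times> real \<times> real \<times> real \<times> real"

definition on_conic :: "conic \<Rightarrow> complex \<Rightarrow> bool" where
  "on_conic K z = (case K of (a,b,c,d,e,f) \<Rightarrow>
     a * (Re z)^2 + b * Re z * Im z + c * (Im z)^2 + d * Re z + e * Im z + f = 0)"

definition is_conic :: "conic \<Rightarrow> bool" where
  "is_conic K = (case K of (a,b,c,d,e,f) \<Rightarrow> (a,b,c) \<noteq> (0,0,0))"

definition is_circle :: "conic \<Rightarrow> bool" where
  "is_circle K = (case K of (a,b,c,d,e,f) \<Rightarrow> a \<noteq> 0 \<and> a = c \<and> b = 0 \<and> d^2 + e^2 > 4*a*f)"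

definition conic_scale :: "real \<Rightarrow> conic \<Rightarrow> conic" where
  "conic_scale t K = (case K of (a,b,c,d,e,f) \<Rightarrow> (t*a,t*b,t*c,t*d,t*e,t*f))"

definition conic_grad :: "conic \<Rightarrow> complex \<Rightarrow> complex" where
  "conic_grad K z = (case K of (a,b,c,d,e,f) \<Rightarrow>
     Complex (2*a*Re z + b*Im z + d) (b*Re z + 2*c*Im z + e))"

definition unique_conic5 :: "complex \<Rightarrow> complex \<Rightarrow> complex \<Rightarrow> complex \<Rightarrow> complex \<Rightarrow> bool" where
  "unique_conic5 p1 p2 p3 p4 p5 =
     ((\<exists>K. is_conic K \<and> (\<forall>p\<in>{p1,p2,p3,p4,p5}. on_conic K p)) \<and>
      (\<forall>K1 K2. is_conic K1 \<and> is_conic K2 \<and> (\<forall>p\<in>{p1,p2,p3,p4,p5}. on_conic K1 p) \<and>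
               (\<forall>p\<in>{p1,p2,p3,p4,p5}. on_conic K2 p) \<longrightarrow> (\<exists>t. t \<noteq> 0 \<and> K2 = conic_scale t K1)))"

text \<open>Two curves are tangent at p: both pass through p and their gradients at p are
  linearly dependent (intersection multiplicity at least 2).\<close>
definition curves_tangent_at :: "conic \<Rightarrow> conic \<Rightarrow> complex \<Rightarrow> bool" where
  "curves_tangent_at K1 K2 p = (on_conic K1 p \<and> on_conic K2 p \<and>
      Im (cnj (conic_grad K1 p) * conic_grad K2 p) = 0)"

definition line_tangent_at :: "complex \<Rightarrow> complex \<Rightarrow> conic \<Rightarrow> complex \<Rightarrow> bool" where
  "line_tangent_at u v K p = (u \<noteq> v \<and> collinear {u, v, p} \<and> on_conic K p \<and>
      Re (cnj (conic_grad K p) * (v - u)) = 0)"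

definition reflect_line :: "complex \<Rightarrow> complex \<Rightarrow> complex \<Rightarrow> complex" where
  "reflect_line Q w z = Q + (w / cnj w) * cnj (z - Q)"

definition bisector_dir :: "complex \<Rightarrow> complex \<Rightarrow> complex \<Rightarrow> complex" where
  "bisector_dir V U W = (U - V) / of_real (cmod (U - V)) + (W - V) / of_real (cmod (W - V))"

definition isogonal_conj :: "complex \<Rightarrow> complex \<Rightarrow> complex \<Rightarrow> complex \<Rightarrow> complex \<Rightarrow> bool" where
  "isogonal_conj A B C P P' =
     (collinear {A, reflect_line A (bisector_dir A B C) P, P'} \<and>
      collinear {B, reflect_line B (bisector_dir B C A) P, P'} \<and>
      collinear {C, reflect_line C (bisector_dir C A B) P, P'})"

end

theory Submission
  imports Defs
begin

text \<open>Take \<open>\<Omega>\<close> to be the unit circle and \<open>D = 1\<close>, and let \<open>s1, s2, s3\<close> be the elementary symmetric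
functions of the vertices. Writing \<open>z~\<close> for the conjugate of \<open>z\<close>, isogonal conjugates \<open>p, q\<close>
satisfy \<open>p + q + s3 p~ q~ = s1\<close>, and a conic through the vertices has an equation
\<open>\<beta> (|z|^2 - 1) + 2 Re (\<alpha> V(z)) = 0\<close> with \<open>V(z) = z^2 - s1 z + s2 - s3 z~\<close>. Its fourth
intersection with the unit circle is \<open>\<alpha>~ / (\<alpha> s3)\<close>. Since \<open>V(p) = s3 q~ (1 - |p|^2)\<close>, it passes
through \<open>p\<close> iff \<open>\<beta> = 2 Re (\<alpha> s3 q~)\<close>; hence \<open>D = 1\<close> means \<open>s3 w~ = - w\<close> for \<open>w = p - q\<close>, and
everything is a rational function of \<open>u = 1 - p\<close>, \<open>v = 1 - q\<close> and their conjugates.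

Both parts exhibit a degenerate member of the pencil spanned by \<open>\<Gamma>\<close> and the conic in question. For
(a) it is the line \<open>PP'\<close> taken twice: a combination of \<open>\<Gamma>\<close> and the squared line vanishes at the
vertices, so by uniqueness it is the conic \<open>(ABCPZ)\<close>, which therefore touches \<open>\<Gamma>\<close> at \<open>P\<close> and
\<open>Z\<close>. For (b) it is the line \<open>PX\<close> together with the line \<open>Z1 Z2\<close>. Projecting \<open>\<Gamma>\<close> from \<open>X\<close> to \<open>\<Omega>\<close>
is the restriction of a similarity, which carries the second line to the tangent of \<open>Q\<close> at \<open>P'\<close>.\<close>

section \<open>Conics in complex coordinates\<close>

lemma Re_eq_0_iff_add_cnj: "Re z = 0 \<longleftrightarrow> z + cnj z = 0"
  by (simp add: complex_add_cnj)

lemma collinear_complex_iff: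
  fixes u v w :: complex
  shows "collinear {u, v, w} \<longleftrightarrow> (v - u) * cnj (w - u) = cnj (v - u) * (w - u)"
proof -
  have "collinear {u, v, w} \<longleftrightarrow> collinear {0, v - u, w - u}"
    using collinear_3[of v u w] by (simp only: NO_MATCH_def insert_commute[of u v] simp_thms)
  also have "\<dots> \<longleftrightarrow> (w - u) / (v - u) \<in> \<real>" by (rule collinear_iff_Reals)
  also have "\<dots> \<longleftrightarrow> (v - u) * cnj (w - u) = cnj (v - u) * (w - u)"
    by (cases "v = u") (auto simp: Reals_cnj_iff field_simps)
  finally show ?thesis .
qed

lemma collinear_unit_chord_iff:
  fixes d x z :: complex
  assumes "d * cnj d = 1" "x * cnj x = 1" "x \<noteq> d"
  shows "collinear {d, x, z} \<longleftrightarrow> z + d * x * cnj z = d + x"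
proof -
  have chord: "d * x * ((x - d) * cnj (z - d) - cnj (x - d) * (z - d))
      = (x - d) * (z + d * x * cnj z - (d + x))"
    using assms(1,2) unfolding complex_cnj_diff by algebra
  have "d * x \<noteq> 0" using assms(1,2) by auto
  hence "collinear {d, x, z} \<longleftrightarrow> d * x * ((x - d) * cnj (z - d) - cnj (x - d) * (z - d)) = 0"
    by (simp only: collinear_complex_iff mult_eq_0_iff right_minus_eq simp_thms)
  thus ?thesis
    using assms(3) by (simp only: chord mult_eq_0_iff right_minus_eq simp_thms)
qed

definition quad_coeff :: "conic \<Rightarrow> complex" where
  "quad_coeff K = (case K of (a,b,c,d,e,f) \<Rightarrow> Complex ((a - c) / 4) (- b / 4))"

definition norm_coeff :: "conic \<Rightarrow> real" where
  "norm_coeff K = (case K of (a,b,c,d,e,f) \<Rightarrow> (a + c) / 2)"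

definition lin_coeff :: "conic \<Rightarrow> complex" where
  "lin_coeff K = (case K of (a,b,c,d,e,f) \<Rightarrow> Complex (d / 2) (- e / 2))"

definition const_coeff :: "conic \<Rightarrow> real" where
  "const_coeff K = (case K of (a,b,c,d,e,f) \<Rightarrow> f)"

definition conic_of :: "complex \<Rightarrow> real \<Rightarrow> complex \<Rightarrow> real \<Rightarrow> conic" where
  "conic_of \<alpha> \<beta> \<gamma> \<delta> = (\<beta> + 2 * Re \<alpha>, - 4 * Im \<alpha>, \<beta> - 2 * Re \<alpha>, 2 * Re \<gamma>, - 2 * Im \<gamma>, \<delta>)"

lemmas coeff_defs = quad_coeff_def norm_coeff_def lin_coeff_def const_coeff_def

lemma coeff_conic_of [simp]:
  "quad_coeff (conic_of \<alpha> \<beta> \<gamma> \<delta>) = \<alpha>" "norm_coeff (conic_of \<alpha> \<beta> \<gamma> \<delta>) = \<beta>"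
  "lin_coeff (conic_of \<alpha> \<beta> \<gamma> \<delta>) = \<gamma>" "const_coeff (conic_of \<alpha> \<beta> \<gamma> \<delta>) = \<delta>"
  by (simp_all add: conic_of_def coeff_defs)

definition conic_form :: "conic \<Rightarrow> complex \<Rightarrow> complex" where
  "conic_form K z = quad_coeff K * z^2 + cnj (quad_coeff K) * (cnj z)^2
     + of_real (norm_coeff K) * (z * cnj z)
     + lin_coeff K * z + cnj (lin_coeff K) * cnj z + of_real (const_coeff K)"

lemma conic_form_conic_of:
  "conic_form (conic_of \<alpha> \<beta> \<gamma> \<delta>) z = \<alpha> * z^2 + cnj \<alpha> * (cnj z)^2 + of_real \<beta> * (z * cnj z)
     + \<gamma> * z + cnj \<gamma> * cnj z + of_real \<delta>"
  by (simp add: conic_form_def)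

lemma cnj_conic_form [simp]: "cnj (conic_form K z) = conic_form K z"
  by (simp add: conic_form_def)

lemma on_conic_iff_form: "on_conic K z \<longleftrightarrow> conic_form K z = 0"
  by (auto simp: on_conic_def conic_form_def coeff_defs complex_eq_iff power2_eq_square field_simps
      split: prod.splits)

lemma cnj_conic_grad:
  "cnj (conic_grad K z) = 2 * (2 * quad_coeff K * z + of_real (norm_coeff K) * cnj z + lin_coeff K)"
  by (simp add: conic_grad_def coeff_defs complex_eq_iff field_simps split: prod.splits)

lemma is_conic_iff_coeff: "is_conic K \<longleftrightarrow> quad_coeff K \<noteq> 0 \<or> norm_coeff K \<noteq> 0"
  by (auto simp: is_conic_def coeff_defs complex_eq_iff split: prod.splits)

lemma is_circle_iff_coeff:
  "is_circle K \<longleftrightarrow> quad_coeff K = 0 \<and> norm_coeff K \<noteq> 0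
     \<and> norm_coeff K * const_coeff K < (cmod (lin_coeff K))^2"
  by (auto simp: is_circle_def coeff_defs complex_eq_iff cmod_power2 power_divide
      split: prod.splits)

lemma conic_form_scale: "conic_form (conic_scale t K) z = of_real t * conic_form K z"
  by (simp add: conic_scale_def conic_form_def coeff_defs complex_eq_iff field_simps
      split: prod.splits)

lemma conic_grad_scale: "conic_grad (conic_scale t K) z = of_real t * conic_grad K z"
  by (simp add: conic_grad_def conic_scale_def complex_eq_iff algebra_simps split: prod.splits)

lemma conic_eqI:
  assumes "\<And>z. conic_form K z = conic_form L z"
  shows "K = L"
  using assms[of 0] assms[of 1] assms[of "- 1"] assms[of \<i>] assms[of "- \<i>"] assms[of "1 + \<i>"]
  by (cases K; cases L)
    (simp add: conic_form_def coeff_defs complex_eq_iff power2_eq_square field_simps)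

definition circle_center :: "conic \<Rightarrow> complex" where
  "circle_center K = - cnj (lin_coeff K) / of_real (norm_coeff K)"

lemma circle_iff_dist_center:
  assumes "is_circle K" "on_conic K d"
  shows "d \<noteq> circle_center K"
    and "on_conic K z \<longleftrightarrow> cmod (z - circle_center K) = cmod (d - circle_center K)"
proof -
  define m \<beta> \<gamma> \<delta> where "m = circle_center K" and "\<beta> = norm_coeff K"
    and "\<gamma> = lin_coeff K" and "\<delta> = const_coeff K"
  have K: "quad_coeff K = 0" "\<beta> \<noteq> 0" "\<beta> * \<delta> < (cmod \<gamma>)^2"
    using assms(1) by (simp_all add: is_circle_iff_coeff \<beta>_def \<gamma>_def \<delta>_def)
  have m: "of_real \<beta> * m = - cnj \<gamma>" "of_real \<beta> * cnj m = - \<gamma>"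
    using K(2) by (simp_all add: m_def circle_center_def \<beta>_def \<gamma>_def)
  have on_iff: "on_conic K z \<longleftrightarrow> \<beta> * \<beta> * (cmod (z - m))^2 = (cmod \<gamma>)^2 - \<beta> * \<delta>" for z
  proof -
    have "of_real \<beta> * conic_form K z
        = of_real (\<beta> * \<beta> * (cmod (z - m))^2 - ((cmod \<gamma>)^2 - \<beta> * \<delta>))"
      using m unfolding of_real_diff of_real_mult complex_norm_square conic_form_def K(1)
        \<beta>_def[symmetric] \<gamma>_def[symmetric] \<delta>_def[symmetric] complex_cnj_diff complex_cnj_zero
      by algebra
    thus ?thesis
      using K(2) unfolding on_conic_iff_form
      by (metis mult_eq_0_iff of_real_eq_0_iff right_minus_eq)
  qed
  show "d \<noteq> circle_center K"
    using assms(2) K(3) unfolding on_iff m_def by auto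
  have "on_conic K z \<longleftrightarrow> \<beta> * \<beta> * (cmod (z - m))^2 = \<beta> * \<beta> * (cmod (d - m))^2"
    using assms(2) unfolding on_iff by simp
  thus "on_conic K z \<longleftrightarrow> cmod (z - circle_center K) = cmod (d - circle_center K)"
    using K(2) by (simp add: m_def power2_eq_iff_nonneg)
qed

definition line_form :: "complex \<Rightarrow> complex \<Rightarrow> complex \<Rightarrow> complex" where
  "line_form p w z = cnj w * (z - p) - w * cnj (z - p)"

lemma collinear_iff_line_form: "collinear {p, q, z} \<longleftrightarrow> line_form p (p - q) z = 0"
  unfolding collinear_complex_iff line_form_def by (auto simp: algebra_simps)

definition double_contact_conic :: "real \<Rightarrow> conic \<Rightarrow> complex \<Rightarrow> complex \<Rightarrow> conic" where
  "double_contact_conic s K p w = conic_of (of_real s * quad_coeff K + (cnj w)^2)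
     (s * norm_coeff K - 2 * (cmod w)^2)
     (of_real s * lin_coeff K - 2 * cnj w * (cnj w * p - w * cnj p))
     (s * const_coeff K + Re ((cnj w * p - w * cnj p)^2))"

lemma conic_form_double_contact_conic:
  "conic_form (double_contact_conic s K p w) z = of_real s * conic_form K z + (line_form p w z)^2"
proof -
  have const: "of_real (Re ((cnj w * p - w * cnj p)^2)) = (cnj w * p - w * cnj p)^2"
    by (simp add: complex_eq_iff power2_eq_square)
  show ?thesis
    unfolding double_contact_conic_def conic_form_conic_of conic_form_def[of K] line_form_def
      of_real_add of_real_diff of_real_mult complex_norm_square const complex_cnj_add
      complex_cnj_diff complex_cnj_mult complex_cnj_power complex_cnj_cnj
      complex_cnj_complex_of_real complex_cnj_numeral of_real_numeral
    by algebra
qed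

lemma conic_grad_double_contact_conic:
  assumes "line_form p w z = 0"
  shows "conic_grad (double_contact_conic s K p w) z = of_real s * conic_grad K z"
proof -
  have "cnj (conic_grad (double_contact_conic s K p w) z)
      = of_real s * cnj (conic_grad K z) + 4 * cnj w * line_form p w z"
    unfolding cnj_conic_grad double_contact_conic_def coeff_conic_of line_form_def
      of_real_diff of_real_mult complex_norm_square complex_cnj_diff of_real_numeral
    by algebra
  hence "cnj (conic_grad (double_contact_conic s K p w) z) = cnj (of_real s * conic_grad K z)"
    using assms by simp
  thus ?thesis by (simp only: complex_cnj_cancel_iff)
qed

lemma is_conic_double_contact_conic:
  assumes "is_circle K" "w \<noteq> 0"
  shows "is_conic (double_contact_conic s K p w)"
  using assms by (simp add: is_conic_iff_coeff is_circle_iff_coeff double_contact_conic_def)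

lemma line_tangent_atI:
  assumes "on_conic K p" "conic_grad K p \<noteq> 0" "u \<noteq> v"
    and "Re (cnj (conic_grad K p) * (u - p)) = 0" "Re (cnj (conic_grad K p) * (v - p)) = 0"
  shows "line_tangent_at u v K p"
proof -
  define n where "n = conic_grad K p"
  have "cnj n * (u - p) + n * cnj (u - p) = 0" "cnj n * (v - p) + n * cnj (v - p) = 0"
    using assms(4,5) unfolding n_def Re_eq_0_iff_add_cnj complex_cnj_mult complex_cnj_cnj .
  hence "cnj n * n * ((v - u) * cnj (p - u) - cnj (v - u) * (p - u)) = 0"
    unfolding complex_cnj_diff by algebra
  hence "collinear {u, v, p}"
    using assms(2) by (simp add: n_def collinear_complex_iff)
  moreover have "Re (cnj n * (v - u)) = 0"
    using assms(4,5) by (simp add: n_def algebra_simps)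
  ultimately show ?thesis
    using assms(1,3) by (simp add: line_tangent_at_def n_def)
qed

lemma bisector_dir_div_cnj:
  assumes "\<not> collinear {A, B, C}"
  shows "bisector_dir A B C / cnj (bisector_dir A B C) = sgn ((B - A) * (C - A))"
proof -
  define U V where "U = sgn (B - A)" and "V = sgn (C - A)"
  have dir: "bisector_dir A B C = U + V"
    by (simp add: bisector_dir_def U_def V_def sgn_eq)
  have "B \<noteq> A" "C \<noteq> A" using assms by (auto simp: insert_commute)
  hence unit: "U * cnj U = 1" "V * cnj V = 1"
    by (simp_all add: U_def V_def norm_sgn flip: complex_norm_square)
  have polar: "B - A = of_real (cmod (B - A)) * U" "C - A = of_real (cmod (C - A)) * V"
    using abs_mult_sgn[of "B - A"] abs_mult_sgn[of "C - A"]
    by (simp_all add: U_def V_def abs_complex_def)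
  have "U + V \<noteq> 0"
  proof
    assume "U + V = 0"
    hence "V = - U" by algebra
    hence "collinear {A, B, C}"
      unfolding collinear_complex_iff by (subst (1 2) polar(1), subst (1 2) polar(2)) simp
    thus False using assms by simp
  qed
  hence "cnj (U + V) \<noteq> 0" by (simp only: complex_cnj_zero_iff not_False_eq_True)
  moreover have "U + V = U * V * cnj (U + V)"
    using unit unfolding complex_cnj_add by algebra
  ultimately have "(U + V) / cnj (U + V) = U * V"
    by (metis nonzero_divide_eq_eq)
  thus ?thesis by (simp add: dir U_def V_def sgn_mult)
qed

lemma isogonal_line_real:
  assumes "\<not> collinear {A, B, C}" "collinear {A, reflect_line A (bisector_dir A B C) P, P'}"
  shows "(P' - A) * (P - A) * cnj ((B - A) * (C - A)) \<in> \<real>"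
proof -
  define W where "W = (B - A) * (C - A)"
  have "reflect_line A (bisector_dir A B C) P - A = sgn W * cnj (P - A)"
    by (simp only: reflect_line_def bisector_dir_div_cnj[OF assms(1)] W_def add_diff_cancel_left')
  hence "sgn W * cnj (P - A) * cnj (P' - A) = cnj (sgn W * cnj (P - A)) * (P' - A)"
    using assms(2) by (simp only: collinear_complex_iff)
  hence "(P' - A) * (P - A) * cnj (sgn W) \<in> \<real>"
    by (simp add: Reals_cnj_iff algebra_simps)
  hence "of_real (cmod W) * ((P' - A) * (P - A) * cnj (sgn W)) \<in> \<real>"
    by simp
  moreover have "cnj W = of_real (cmod W) * cnj (sgn W)"
    using arg_cong[OF abs_mult_sgn[of W], of cnj] by (simp add: abs_complex_def)
  ultimately show ?thesis
    by (simp add: W_def mult_ac)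
qed

section \<open>Change of coordinates\<close>

locale complex_frame =
  fixes origin unit :: complex
  assumes unit_nonzero [simp]: "unit \<noteq> 0"
begin

definition coord :: "complex \<Rightarrow> complex" where
  "coord z = (z - origin) / unit"

definition conic_coord :: "conic \<Rightarrow> conic" where
  "conic_coord K = conic_of (quad_coeff K * unit^2) (norm_coeff K * (cmod unit)^2)
     (unit * (2 * quad_coeff K * origin + of_real (norm_coeff K) * cnj origin + lin_coeff K))
     (Re (conic_form K origin))"

lemma coord_diff: "coord z - coord w = (z - w) / unit"
  by (simp add: coord_def diff_divide_distrib)

lemma coord_eq_iff [simp]: "coord z = coord w \<longleftrightarrow> z = w"
  by (simp add: coord_def)

lemma origin_add_unit_coord: "origin + unit * coord z = z"
  by (simp add: coord_def)

lemma coordE: obtains z where "w = coord z"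
  using that[of "origin + unit * w"] by (simp add: coord_def)

lemma conic_form_conic_coord: "conic_form (conic_coord K) w = conic_form K (origin + unit * w)"
proof -
  have const: "of_real (Re (conic_form K origin)) = conic_form K origin"
    by (metis Reals_cnj_iff cnj_conic_form of_real_Re)
  show ?thesis
    unfolding conic_coord_def conic_form_conic_of const of_real_mult complex_norm_square
    unfolding conic_form_def complex_cnj_add complex_cnj_mult complex_cnj_power
      complex_cnj_complex_of_real complex_cnj_cnj complex_cnj_numeral
    by algebra
qed

lemma conic_form_coord [simp]: "conic_form (conic_coord K) (coord z) = conic_form K z"
  by (simp add: conic_form_conic_coord origin_add_unit_coord)

lemma on_conic_coord [simp]: "on_conic (conic_coord K) (coord z) \<longleftrightarrow> on_conic K z"
  by (simp add: on_conic_iff_form)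

lemma is_conic_coord [simp]: "is_conic (conic_coord K) \<longleftrightarrow> is_conic K"
  by (simp add: is_conic_iff_coeff conic_coord_def)

lemma is_circle_coord [simp]: "is_circle (conic_coord K) \<longleftrightarrow> is_circle K"
proof (cases "quad_coeff K = 0")
  case True
  have "(cmod (lin_coeff (conic_coord K)))^2
        - norm_coeff (conic_coord K) * const_coeff (conic_coord K)
      = (cmod unit)^2 * ((cmod (of_real (norm_coeff K) * cnj origin + lin_coeff K))^2
        - norm_coeff K * Re (conic_form K origin))"
    using True by (simp add: conic_coord_def norm_mult power_mult_distrib right_diff_distrib
        mult.left_commute)
  also have "\<dots> = (cmod unit)^2 * ((cmod (lin_coeff K))^2 - norm_coeff K * const_coeff K)"
    using True unfolding cmod_power2 by (simp add: conic_form_def power2_eq_square algebra_simps)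
  finally have "0 < (cmod (lin_coeff (conic_coord K)))^2
        - norm_coeff (conic_coord K) * const_coeff (conic_coord K)
      \<longleftrightarrow> 0 < (cmod (lin_coeff K))^2 - norm_coeff K * const_coeff K"
    by (simp only: zero_less_mult_iff) simp
  thus ?thesis
    unfolding is_circle_iff_coeff by (simp add: conic_coord_def)
next
  case False
  thus ?thesis by (simp add: is_circle_iff_coeff conic_coord_def)
qed

lemma conic_grad_coord: "conic_grad (conic_coord K) (coord z) = cnj unit * conic_grad K z"
proof -
  have "cnj (conic_grad (conic_coord K) w) = unit * cnj (conic_grad K (origin + unit * w))" for w
    unfolding cnj_conic_grad conic_coord_def coeff_conic_of of_real_mult complex_norm_square
      complex_cnj_add complex_cnj_mult by algebra
  hence "cnj (conic_grad (conic_coord K) (coord z)) = cnj (cnj unit * conic_grad K z)"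
    by (simp add: origin_add_unit_coord)
  thus ?thesis by (simp only: complex_cnj_cancel_iff)
qed

lemma conic_coord_scale: "conic_coord (conic_scale t K) = conic_scale t (conic_coord K)"
proof (rule conic_eqI)
  fix w
  obtain z where "w = coord z" by (rule coordE)
  thus "conic_form (conic_coord (conic_scale t K)) w = conic_form (conic_scale t (conic_coord K)) w"
    by (simp add: conic_form_scale)
qed

lemma conic_coordE: obtains L where "K = conic_coord L"
proof -
  interpret inverse: complex_frame "- (origin / unit)" "1 / unit"
    by unfold_locales simp
  have inv: "inverse.coord (coord z) = z" for z
    by (simp add: coord_def inverse.coord_def field_simps)
  have "K = conic_coord (inverse.conic_coord K)"
  proof (rule conic_eqI)
    fix w
    obtain z where w: "w = coord z" by (rule coordE)
    have "conic_form (conic_coord (inverse.conic_coord K)) w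
        = conic_form (inverse.conic_coord K) (inverse.coord w)" by (simp add: w inv)
    thus "conic_form K w = conic_form (conic_coord (inverse.conic_coord K)) w" by simp
  qed
  thus thesis by (rule that)
qed

lemma collinear_coord [simp]: "collinear {coord u, coord v, coord w} \<longleftrightarrow> collinear {u, v, w}"
  by (simp add: collinear_complex_iff coord_diff mult.commute[of "cnj unit"] flip: complex_cnj_diff)

lemma curves_tangent_at_coord [simp]:
  "curves_tangent_at (conic_coord K) (conic_coord L) (coord z) \<longleftrightarrow> curves_tangent_at K L z"
proof -
  have "Im (cnj (cnj unit * g) * (cnj unit * h)) = (cmod unit)^2 * Im (cnj g * h)" for g h
    unfolding cmod_power2 by (simp add: power2_eq_square algebra_simps)
  thus ?thesis
    unfolding curves_tangent_at_def conic_grad_coord by simp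
qed

lemma line_tangent_at_coord [simp]:
  "line_tangent_at (coord u) (coord v) (conic_coord K) (coord z) \<longleftrightarrow> line_tangent_at u v K z"
  by (simp add: line_tangent_at_def conic_grad_coord coord_diff)

lemma unique_conic5_coord:
  assumes "unique_conic5 p1 p2 p3 p4 p5"
  shows "unique_conic5 (coord p1) (coord p2) (coord p3) (coord p4) (coord p5)"
  unfolding unique_conic5_def
proof (intro conjI allI impI)
  obtain K where "is_conic K" "\<forall>p\<in>{p1, p2, p3, p4, p5}. on_conic K p"
    using assms by (auto simp: unique_conic5_def)
  hence "is_conic (conic_coord K)"
    "\<forall>p\<in>{coord p1, coord p2, coord p3, coord p4, coord p5}. on_conic (conic_coord K) p" by auto
  thus "\<exists>K. is_conic K \<and> (\<forall>p\<in>{coord p1, coord p2, coord p3, coord p4, coord p5}. on_conic K p)"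
    by blast
next
  fix K L
  assume KL: "is_conic K \<and> is_conic L
    \<and> (\<forall>p\<in>{coord p1, coord p2, coord p3, coord p4, coord p5}. on_conic K p)
    \<and> (\<forall>p\<in>{coord p1, coord p2, coord p3, coord p4, coord p5}. on_conic L p)"
  obtain K' L' where coords: "K = conic_coord K'" "L = conic_coord L'"
    by (metis conic_coordE)
  have "is_conic K'" "is_conic L'" "\<forall>p\<in>{p1, p2, p3, p4, p5}. on_conic K' p"
    "\<forall>p\<in>{p1, p2, p3, p4, p5}. on_conic L' p"
    using KL by (auto simp: coords)
  then obtain t where "t \<noteq> 0" "L' = conic_scale t K'"
    using assms unfolding unique_conic5_def by blast
  thus "\<exists>t. t \<noteq> 0 \<and> L = conic_scale t K"
    by (auto simp: coords conic_coord_scale)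
qed

lemma bisector_dir_coord:
  "bisector_dir (coord V) (coord U) (coord W) = of_real (cmod unit) * bisector_dir V U W / unit"
proof -
  have "(z / unit) / of_real (cmod (z / unit))
      = of_real (cmod unit) * (z / of_real (cmod z)) / unit" for z
    by (simp add: norm_divide mult.commute)
  thus ?thesis
    by (simp only: bisector_dir_def coord_diff add_divide_distrib distrib_left)
qed

lemma reflect_line_coord:
  "reflect_line (coord Q) (of_real (cmod unit) * w / unit) (coord z) = coord (reflect_line Q w z)"
proof -
  have "(of_real (cmod unit) * w / unit) / cnj (of_real (cmod unit) * w / unit)
      = (w / cnj w) * (cnj unit / unit)" by simp
  thus ?thesis
    by (simp add: reflect_line_def coord_diff)
      (simp add: coord_def add_divide_distrib diff_divide_distrib)
qed

lemma isogonal_conj_coord [simp]: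
  "isogonal_conj (coord A) (coord B) (coord C) (coord P) (coord P') \<longleftrightarrow> isogonal_conj A B C P P'"
  by (simp add: isogonal_conj_def bisector_dir_coord reflect_line_coord)

end

section \<open>Triangles inscribed in the unit circle\<close>

lemma conic_form_circle_unit_chord:
  assumes "is_circle K" "x * cnj x = 1" "y * cnj y = 1" "x \<noteq> y" "on_conic K x" "on_conic K y"
  shows "conic_form K z = of_real (norm_coeff K) * (z * cnj z - 1)
    + lin_coeff K * (z + x * y * cnj z - x - y)"
proof -
  define g \<gamma> \<delta> where "g = complex_of_real (norm_coeff K)" and "\<gamma> = lin_coeff K"
    and "\<delta> = complex_of_real (const_coeff K)"
  have form: "conic_form K t = g * (t * cnj t) + \<gamma> * t + cnj \<gamma> * cnj t + \<delta>" for t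
    using assms(1) by (simp add: conic_form_def is_circle_iff_coeff g_def \<gamma>_def \<delta>_def)
  have on_K: "g + \<delta> + \<gamma> * x + cnj \<gamma> * cnj x = 0" "g + \<delta> + \<gamma> * y + cnj \<gamma> * cnj y = 0"
    using assms unfolding on_conic_iff_form form by (simp_all add: algebra_simps)
  have "(x - y) * (\<gamma> * x * y - cnj \<gamma>) = 0" using on_K assms(2,3) by algebra
  hence cnj_lin: "cnj \<gamma> = \<gamma> * x * y" using assms(4) by simp
  hence "g + \<delta> = - \<gamma> * (x + y)" using on_K(1) assms(2) by algebra
  thus ?thesis using cnj_lin unfolding form g_def[symmetric] \<gamma>_def[symmetric] by algebra
qed

lemma isogonal_line_unit_circle:
  fixes a b c p q :: complex
  assumes "a * cnj a = 1" "b * cnj b = 1" "c * cnj c = 1" "b \<noteq> a" "c \<noteq> a"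
    and "(q - a) * (p - a) * cnj ((b - a) * (c - a)) \<in> \<real>"
  shows "p * q + a * b * c * (cnj p + cnj q) - (a * b + b * c + c * a)
    = a * (p + q + a * b * c * cnj p * cnj q - (a + b + c))"
proof -
  have "(b - a) * (c - a) * (p * q + a * b * c * (cnj p + cnj q) - (a * b + b * c + c * a)
    - a * (p + q + a * b * c * cnj p * cnj q - (a + b + c))) = 0"
    using assms(1-3,6) unfolding Reals_cnj_iff complex_cnj_mult complex_cnj_diff complex_cnj_cnj
    by algebra
  thus ?thesis using assms(4,5) by simp
qed

locale unit_triangle =
  fixes a b c :: complex
  assumes vertices_unit: "a * cnj a = 1" "b * cnj b = 1" "c * cnj c = 1"
    and vertices_noncollinear: "\<not> collinear {a, b, c}"
begin

lemma vertices_distinct: "a \<noteq> b" "b \<noteq> c" "c \<noteq> a"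
  using vertices_noncollinear by (auto simp: insert_commute)

definition s1 :: complex where "s1 = a + b + c"
definition s2 :: complex where "s2 = a * b + b * c + c * a"
definition s3 :: complex where "s3 = a * b * c"

definition vertex_form :: "complex \<Rightarrow> complex" where
  "vertex_form z = z^2 - s1 * z + s2 - s3 * cnj z"

definition circumconic :: "conic \<Rightarrow> bool" where
  "circumconic K \<longleftrightarrow> on_conic K a \<and> on_conic K b \<and> on_conic K c"

lemma s3_unit: "s3 * cnj s3 = 1"
  unfolding s3_def complex_cnj_mult using vertices_unit by algebra

lemma s2_eq: "s2 = s3 * cnj s1" and cnj_s2: "cnj s2 = cnj s3 * s1"
  unfolding s1_def s2_def s3_def complex_cnj_add complex_cnj_mult using vertices_unit by algebra+

lemma cnj_vertex_form: "cnj (vertex_form z) = (cnj z)^2 - cnj s1 * cnj z + cnj s2 - cnj s3 * z"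
  by (simp add: vertex_form_def)

lemma vertex_form_unit:
  assumes "z * cnj z = 1"
  shows "z * vertex_form z = (z - a) * (z - b) * (z - c)"
  using assms unfolding vertex_form_def s1_def s2_def s3_def by algebra

lemma vertex_form_vertex: "vertex_form a = 0" "vertex_form b = 0" "vertex_form c = 0"
proof -
  have "vertex_form z = 0" if "z * cnj z = 1" "z \<in> {a, b, c}" for z
    using that vertex_form_unit[of z] by auto
  thus "vertex_form a = 0" "vertex_form b = 0" "vertex_form c = 0" using vertices_unit by auto
qed

lemma cnj_vertex_form_unit:
  assumes "z * cnj z = 1"
  shows "s3 * z * cnj (vertex_form z) = - vertex_form z"
  using assms s3_unit s2_eq cnj_s2
  unfolding cnj_vertex_form unfolding vertex_form_def by algebra

lemma circumconic_coeffs: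
  assumes "circumconic K"
  shows "lin_coeff K = - quad_coeff K * s1 - cnj (quad_coeff K) * cnj s3" (is "_ = ?lin")
    and "of_real (norm_coeff K + const_coeff K) = quad_coeff K * s2 + cnj (quad_coeff K) * cnj s2"
      (is "?sum = ?sum'")
proof -
  define m n where "m = ?sum - ?sum'" and "n = lin_coeff K - ?lin"
  have "[:cnj n, m, n:] = 0"
  proof (rule poly_eqI_degree)
    fix z assume z: "z \<in> {a, b, c}"
    have z_unit: "z * cnj z = 1" and on_K: "conic_form K z = 0" and vertex: "vertex_form z = 0"
      using z vertices_unit assms vertex_form_vertex
      by (auto simp: circumconic_def on_conic_iff_form)
    have "cnj (vertex_form z) = 0" by (simp add: vertex)
    hence "cnj n + m * z + n * z^2 = 0"
      using z_unit on_K vertex unfolding conic_form_def cnj_vertex_form m_def n_def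
      unfolding vertex_form_def of_real_add complex_cnj_diff complex_cnj_mult complex_cnj_cnj
        complex_cnj_minus by algebra
    thus "poly [:cnj n, m, n:] z = poly 0 z" by (simp add: power2_eq_square algebra_simps)
  next
    have "card {a, b, c} = 3" using vertices_distinct by auto
    thus "degree [:cnj n, m, n:] < card {a, b, c}" "degree (0 :: complex poly) < card {a, b, c}"
      by (simp_all add: degree_pCons_eq_if)
  qed
  thus "lin_coeff K = ?lin" "?sum = ?sum'" by (simp_all add: m_def n_def)
qed

lemma circumconic_form:
  assumes "circumconic K"
  shows "conic_form K z = of_real (norm_coeff K) * (z * cnj z - 1)
    + quad_coeff K * vertex_form z + cnj (quad_coeff K) * cnj (vertex_form z)"
proof -
  have lin: "cnj (lin_coeff K) = - cnj (quad_coeff K) * cnj s1 - quad_coeff K * s3"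
    using arg_cong[OF circumconic_coeffs(1)[OF assms], of cnj] by simp
  show ?thesis
    using circumconic_coeffs[OF assms] lin
    unfolding conic_form_def cnj_vertex_form unfolding vertex_form_def of_real_add by algebra
qed

lemma cnj_quad_coeff_circumconic:
  assumes "circumconic K" "on_conic K d" "d * cnj d = 1" "d \<notin> {a, b, c}"
  shows "cnj (quad_coeff K) = d * s3 * quad_coeff K"
proof -
  have "vertex_form d \<noteq> 0" using vertex_form_unit[OF assms(3)] assms(4) by auto
  moreover have "vertex_form d * (d * s3 * quad_coeff K - cnj (quad_coeff K)) = 0"
    using circumconic_form[OF assms(1), of d] assms(2,3) cnj_vertex_form_unit[OF assms(3)]
    unfolding on_conic_iff_form by algebra
  ultimately show ?thesis by simp
qed

lemma isogonal_conj_eq: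
  assumes "isogonal_conj a b c p q"
  shows "s1 = p + q + s3 * cnj p * cnj q"
proof -
  define M N where "M = p * q + s3 * (cnj p + cnj q) - s2" and "N = p + q + s3 * cnj p * cnj q - s1"
  have "\<not> collinear {b, c, a}" using vertices_noncollinear by (simp add: insert_commute)
  hence "(q - a) * (p - a) * cnj ((b - a) * (c - a)) \<in> \<real>"
    "(q - b) * (p - b) * cnj ((c - b) * (a - b)) \<in> \<real>"
    using assms vertices_noncollinear
    by (auto simp only: isogonal_conj_def intro!: isogonal_line_real)
  hence "M = a * N" "M = b * N"
    using isogonal_line_unit_circle[of a b c q p] isogonal_line_unit_circle[of b c a q p]
      vertices_unit vertices_distinct
    by (auto simp: M_def N_def s1_def s2_def s3_def algebra_simps)
  hence "(a - b) * N = 0" by algebra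
  thus ?thesis using vertices_distinct by (simp add: N_def)
qed

lemma s2_isogonal:
  assumes "s1 = p + q + s3 * cnj p * cnj q"
  shows "s2 = s3 * (cnj p + cnj q) + p * q"
proof -
  have "cnj s1 = cnj p + cnj q + cnj s3 * p * q" by (simp add: assms)
  thus ?thesis using s2_eq s3_unit by algebra
qed

lemma vertex_form_isogonal:
  assumes "s1 = p + q + s3 * cnj p * cnj q"
  shows "vertex_form p = s3 * cnj q * (1 - p * cnj p)"
  unfolding vertex_form_def s2_isogonal[OF assms] assms by algebra

lemma norm_coeff_circumconic:
  assumes "circumconic K" "on_conic K p" "p * cnj p \<noteq> 1" "s1 = p + q + s3 * cnj p * cnj q"
  shows "of_real (norm_coeff K) = quad_coeff K * s3 * cnj q + cnj (quad_coeff K) * cnj s3 * q"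
proof -
  have "cnj (vertex_form p) = cnj s3 * q * (1 - p * cnj p)"
    by (simp add: vertex_form_isogonal[OF assms(4)])
  hence "(p * cnj p - 1) * (of_real (norm_coeff K) - quad_coeff K * s3 * cnj q
      - cnj (quad_coeff K) * cnj s3 * q) = 0"
    using circumconic_form[OF assms(1), of p] assms(2) vertex_form_isogonal[OF assms(4)]
    unfolding on_conic_iff_form by algebra
  hence "of_real (norm_coeff K) - quad_coeff K * s3 * cnj q - cnj (quad_coeff K) * cnj s3 * q = 0"
    using assms(3) by simp
  thus ?thesis by algebra
qed

lemma quad_coeff_circumconic_nonzero:
  assumes "is_conic K" "circumconic K" "on_conic K p" "p * cnj p \<noteq> 1"
    and "s1 = p + q + s3 * cnj p * cnj q"
  shows "quad_coeff K \<noteq> 0"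
  using assms(1) norm_coeff_circumconic[OF assms(2-5)] by (auto simp: is_conic_iff_coeff)

lemma isogonal_off_circle:
  assumes "s1 = p + q + s3 * cnj p * cnj q"
    and "\<not> collinear {a, b, p}" "\<not> collinear {b, c, p}" "\<not> collinear {c, a, p}"
  shows "q * cnj q \<noteq> 1"
proof
  assume q: "q * cnj q = 1"
  have "vertex_form q = 0"
    using vertex_form_isogonal[of q p] assms(1) q by (simp add: algebra_simps)
  hence "q \<in> {a, b, c}" using vertex_form_unit[OF q] by auto
  moreover have "p + b * c * cnj p = b + c" if "q = a"
    using assms(1) vertices_unit that unfolding s1_def s3_def by algebra
  moreover have "p + c * a * cnj p = c + a" if "q = b"
    using assms(1) vertices_unit that unfolding s1_def s3_def by algebra
  moreover have "p + a * b * cnj p = a + b" if "q = c"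
    using assms(1) vertices_unit that unfolding s1_def s3_def by algebra
  ultimately show False
    using assms(2-4) vertices_unit vertices_distinct collinear_unit_chord_iff by blast
qed

end

section \<open>The configuration\<close>

locale isogonal_configuration =
  fixes A B C P P' D X Y :: complex and \<Omega> Q \<Gamma> :: conic
  assumes triangle: "\<not> collinear {A, B, C}"
    and circumcircle: "is_circle \<Omega>" "on_conic \<Omega> A" "on_conic \<Omega> B" "on_conic \<Omega> C"
    and P_off_sides: "\<not> collinear {A, B, P}" "\<not> collinear {B, C, P}" "\<not> collinear {C, A, P}"
    and P_off_circumcircle: "\<not> on_conic \<Omega> P"
    and isogonal: "isogonal_conj A B C P P'" and P_neq_P': "P \<noteq> P'"
    and Q_conic: "is_conic Q" "on_conic Q A" "on_conic Q B" "on_conic Q C"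
      "on_conic Q P" "on_conic Q P'"
    and D_on: "on_conic \<Omega> D" "on_conic Q D" "D \<notin> {A, B, C}"
    and X_on: "on_conic \<Omega> X" "collinear {D, P, X}" "X \<noteq> D"
    and Y_on: "on_conic \<Omega> Y" "collinear {D, P', Y}" "Y \<noteq> D"
    and X_neq_Y: "X \<noteq> Y"
    and circle_PXY: "is_circle \<Gamma>" "on_conic \<Gamma> P" "on_conic \<Gamma> X" "on_conic \<Gamma> Y"

locale normalized_configuration = isogonal_configuration a b c p q 1 x y \<Omega> Q \<Gamma>
  for a b c p q x y \<Omega> Q \<Gamma> +
  assumes on_circumcircle_iff: "on_conic \<Omega> z \<longleftrightarrow> z * cnj z = 1"
begin

sublocale unit_triangle a b c
  using circumcircle triangle by unfold_locales (auto simp: on_circumcircle_iff)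

definition u :: complex where "u = 1 - p"
definition v :: complex where "v = 1 - q"
definition w :: complex where "w = p - q"
definition \<sigma> :: complex where "\<sigma> = v + cnj v"
definition \<kappa> :: complex where "\<kappa> = \<sigma> - u * cnj v"

lemmas uvw_expand = u_def v_def w_def complex_cnj_diff complex_cnj_one

lemma isogonal_eq: "s1 = p + q + s3 * cnj p * cnj q"
  and isogonal_eq_swap: "s1 = q + p + s3 * cnj q * cnj p"
  using isogonal_conj_eq[OF isogonal] by (simp_all add: algebra_simps)

lemma p_off_circle: "p * cnj p \<noteq> 1"
  using P_off_circumcircle by (simp add: on_circumcircle_iff)

lemma q_off_circle: "q * cnj q \<noteq> 1"
  using isogonal_eq P_off_sides by (rule isogonal_off_circle)

lemma x_unit: "x * cnj x = 1" and y_unit: "y * cnj y = 1"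
  using X_on(1) Y_on(1) by (simp_all add: on_circumcircle_iff)

lemma uvw_nonzero: "u \<noteq> 0" "v \<noteq> 0" "w \<noteq> 0"
  using p_off_circle q_off_circle P_neq_P' by (auto simp: u_def v_def w_def)

lemma x_chord: "p + x * cnj p = 1 + x" and y_chord: "q + y * cnj q = 1 + y"
  using X_on Y_on x_unit y_unit
    collinear_unit_chord_iff[of 1 x p] collinear_unit_chord_iff[of 1 y q]
  by (simp_all add: insert_commute)

lemma cnj_u_mult_x: "cnj u * x = - u" and cnj_v_mult_y: "cnj v * y = - v"
  using x_chord y_chord unfolding uvw_expand by algebra+

lemma cnj_\<sigma>: "cnj \<sigma> = \<sigma>"
  by (simp add: \<sigma>_def)

lemma cnj_\<kappa>: "cnj \<kappa> = \<sigma> - cnj u * v"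
  by (simp add: \<kappa>_def cnj_\<sigma>)

lemma \<sigma>_nonzero: "\<sigma> \<noteq> 0"
proof
  assume "\<sigma> = 0"
  hence "cnj v * (y - 1) = 0" using cnj_v_mult_y unfolding \<sigma>_def by algebra
  thus False using uvw_nonzero Y_on(3) by simp
qed

lemma \<kappa>_nonzero: "\<kappa> \<noteq> 0"
proof
  assume "\<kappa> = 0"
  hence "cnj v * (p - y) = 0" using cnj_v_mult_y unfolding \<kappa>_def \<sigma>_def u_def by algebra
  thus False using uvw_nonzero p_off_circle y_unit by auto
qed

lemma circumconic_Q: "circumconic Q"
  using Q_conic by (simp add: circumconic_def)

lemma cnj_quad_coeff_Q: "cnj (quad_coeff Q) = s3 * quad_coeff Q"
  using cnj_quad_coeff_circumconic[OF circumconic_Q, of 1] D_on by simp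

lemma norm_coeff_Q:
  "of_real (norm_coeff Q) = quad_coeff Q * (s3 * cnj q + q)"
  "of_real (norm_coeff Q) = quad_coeff Q * (s3 * cnj p + p)"
proof -
  show "of_real (norm_coeff Q) = quad_coeff Q * (s3 * cnj q + q)"
    using norm_coeff_circumconic[OF circumconic_Q Q_conic(5) p_off_circle isogonal_eq]
      cnj_quad_coeff_Q s3_unit by algebra
  show "of_real (norm_coeff Q) = quad_coeff Q * (s3 * cnj p + p)"
    using norm_coeff_circumconic[OF circumconic_Q Q_conic(6) q_off_circle isogonal_eq_swap]
      cnj_quad_coeff_Q s3_unit by algebra
qed

lemma quad_coeff_Q_nonzero: "quad_coeff Q \<noteq> 0"
  using quad_coeff_circumconic_nonzero[OF Q_conic(1) circumconic_Q Q_conic(5)]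
    p_off_circle isogonal_eq by simp

lemma s3_mult_cnj_w: "s3 * cnj w = - w"
proof -
  have "quad_coeff Q * (s3 * cnj w + w) = 0"
    using norm_coeff_Q unfolding uvw_expand by algebra
  thus ?thesis using quad_coeff_Q_nonzero by (simp add: eq_neg_iff_add_eq_0)
qed

lemma conic_grad_Q: "cnj (conic_grad Q q) = - 2 * quad_coeff Q * \<kappa>"
proof -
  have lin: "lin_coeff Q = - quad_coeff Q * (1 + s1)"
    using circumconic_coeffs(1)[OF circumconic_Q] cnj_quad_coeff_Q s3_unit by algebra
  have "2 * q + (s3 * cnj q + q) * cnj q - (1 + s1) + \<kappa> = 0"
    using isogonal_eq s3_mult_cnj_w unfolding \<kappa>_def \<sigma>_def uvw_expand by algebra
  thus ?thesis
    unfolding cnj_conic_grad norm_coeff_Q(1) lin by algebra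
qed

definition circle_form :: "complex \<Rightarrow> complex" where
  "circle_form z = \<sigma> * (z * cnj z - 1) + cnj u * cnj v * z + u * v * cnj z + u * cnj v + cnj u * v"

lemma conic_form_\<Gamma>: "\<sigma> * conic_form \<Gamma> z = of_real (norm_coeff \<Gamma>) * circle_form z"
proof -
  note form = conic_form_circle_unit_chord[OF circle_PXY(1) x_unit y_unit X_neq_Y circle_PXY(3,4)]
  define g \<gamma> where "g = complex_of_real (norm_coeff \<Gamma>)" and "\<gamma> = lin_coeff \<Gamma>"
  have "g * (p * cnj p - 1) + \<gamma> * (p + x * y * cnj p - x - y) = 0"
    using circle_PXY(2) by (simp add: on_conic_iff_form form g_def \<gamma>_def)
  hence "(p * cnj p - 1) * (\<gamma> * \<sigma> - g * cnj u * cnj v) = 0"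
    using cnj_u_mult_x cnj_v_mult_y unfolding \<sigma>_def uvw_expand by algebra
  hence "\<gamma> * \<sigma> = g * cnj u * cnj v" using p_off_circle by simp
  thus ?thesis
    using cnj_u_mult_x cnj_v_mult_y
    unfolding form circle_form_def g_def[symmetric] \<gamma>_def[symmetric] by algebra
qed

lemma on_\<Gamma>_iff: "on_conic \<Gamma> z \<longleftrightarrow> circle_form z = 0"
proof -
  have "norm_coeff \<Gamma> \<noteq> 0" using circle_PXY(1) by (simp add: is_circle_iff_coeff)
  thus ?thesis
    using conic_form_\<Gamma>[of z] \<sigma>_nonzero unfolding on_conic_iff_form by auto
qed

lemma circle_form_add_line_form_square:
  "w * cnj w * circle_form z + (line_form p w z)^2
    = w * cnj w * (\<sigma> - 2) * (z * cnj z - 1) + (cnj w)^2 * vertex_form z + w^2 * cnj (vertex_form z)"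
proof -
  have cnj_s1: "cnj s1 = cnj p + cnj q + cnj s3 * p * q"
    using arg_cong[OF isogonal_eq, of cnj] by simp
  have w: "cnj s3 * w = - cnj w"
    using arg_cong[OF s3_mult_cnj_w, of cnj] by simp
  show ?thesis
    using s3_mult_cnj_w w
    unfolding circle_form_def line_form_def cnj_vertex_form cnj_s1 cnj_s2
    unfolding vertex_form_def s2_isogonal[OF isogonal_eq] isogonal_eq \<sigma>_def uvw_expand by algebra
qed

definition contact_scale :: real where
  "contact_scale = Re \<sigma> * (cmod w)^2 / norm_coeff \<Gamma>"

lemma contact_scale_conic_form_\<Gamma>:
  "of_real contact_scale * conic_form \<Gamma> z = w * cnj w * circle_form z"
proof -
  have "of_real (Re \<sigma>) = \<sigma>" by (simp add: \<sigma>_def complex_eq_iff)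
  hence "of_real contact_scale * conic_form \<Gamma> z
      = w * cnj w * (\<sigma> * conic_form \<Gamma> z) / of_real (norm_coeff \<Gamma>)"
    unfolding contact_scale_def of_real_divide of_real_mult complex_norm_square by simp
  thus ?thesis using circle_PXY(1) by (simp add: conic_form_\<Gamma> is_circle_iff_coeff)
qed

lemma circumconic_double_contact_conic:
  "circumconic (double_contact_conic contact_scale \<Gamma> p w)"
proof -
  have "conic_form (double_contact_conic contact_scale \<Gamma> p w) z = 0"
    if "z * cnj z = 1" "vertex_form z = 0" for z
    using circle_form_add_line_form_square[of z] that
    by (simp add: conic_form_double_contact_conic contact_scale_conic_form_\<Gamma>)
  thus ?thesis
    using vertices_unit vertex_form_vertex by (simp add: circumconic_def on_conic_iff_form)
qed

lemma normalized_double_contact: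
  assumes Z: "on_conic \<Gamma> z" "collinear {p, q, z}" and unique: "unique_conic5 a b c p z"
    and K: "is_conic K" "on_conic K a" "on_conic K b" "on_conic K c" "on_conic K p" "on_conic K z"
  shows "curves_tangent_at \<Gamma> K p" "curves_tangent_at \<Gamma> K z"
proof -
  define L where "L = double_contact_conic contact_scale \<Gamma> p w"
  have on_line: "line_form p w p = 0" "line_form p w z = 0"
    using Z(2) by (simp_all add: line_form_def collinear_iff_line_form w_def)
  have "is_conic L"
    using circle_PXY(1) uvw_nonzero(3) by (simp add: L_def is_conic_double_contact_conic)
  moreover have "circumconic L"
    unfolding L_def by (rule circumconic_double_contact_conic)
  moreover have "on_conic L p" "on_conic L z"
    using on_line circle_PXY(2) Z(1)
    by (simp_all add: L_def on_conic_iff_form conic_form_double_contact_conic)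
  ultimately obtain t where "K = conic_scale t L"
    using unique K unfolding unique_conic5_def circumconic_def by blast
  hence "conic_grad K t' = of_real (t * contact_scale) * conic_grad \<Gamma> t'"
    if "line_form p w t' = 0" for t'
    using that by (simp add: L_def conic_grad_scale conic_grad_double_contact_conic)
  thus "curves_tangent_at \<Gamma> K p" "curves_tangent_at \<Gamma> K z"
    using on_line circle_PXY(2) Z(1) K by (simp_all add: curves_tangent_at_def)
qed

text \<open>If \<open>x\<close> were a vertex, \<open>Q\<close> would contain the line through \<open>1\<close>, \<open>p\<close> and \<open>x\<close>, and \<open>q\<close> would
lie on it as well.\<close>
lemma x_not_vertex: "x \<notin> {a, b, c}"
proof
  assume "x \<in> {a, b, c}"
  hence "vertex_form x = 0" using vertex_form_vertex by auto
  hence "(x - p) * (x - p) * (1 + x - q - x * cnj q) = 0"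
    using s3_mult_cnj_w x_unit x_chord
    unfolding vertex_form_def s2_isogonal[OF isogonal_eq] isogonal_eq uvw_expand by algebra
  hence "1 + x - q - x * cnj q = 0" using p_off_circle x_unit by auto
  hence "cnj v * (x - y) = 0" using cnj_v_mult_y unfolding uvw_expand by algebra
  thus False using uvw_nonzero X_neq_Y by simp
qed

definition tangent_form :: "complex \<Rightarrow> complex" where
  "tangent_form z = \<kappa> * (z - q) + s3 * cnj \<kappa> * cnj (z - q)"

lemma perpendicular_conic_grad_Q_iff:
  "Re (cnj (conic_grad Q q) * (z - q)) = 0 \<longleftrightarrow> tangent_form z = 0"
proof -
  have "cnj (conic_grad Q q) * (z - q) + cnj (cnj (conic_grad Q q) * (z - q))
      = - 2 * quad_coeff Q * tangent_form z"
    unfolding conic_grad_Q complex_cnj_mult complex_cnj_minus complex_cnj_numeral cnj_quad_coeff_Q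
      tangent_form_def by algebra
  thus ?thesis
    using quad_coeff_Q_nonzero by (simp only: Re_eq_0_iff_add_cnj) simp
qed

definition projection :: "complex \<Rightarrow> complex" where
  "projection z = (\<sigma> * z + u * v) / \<kappa>"

lemma projection_\<Gamma>:
  assumes "on_conic \<Gamma> z" "z \<noteq> x" "z + x * t * cnj z = x + t"
  shows "projection z = t"
proof -
  have "(z - x) * (\<sigma> * z + u * v - \<kappa> * t) = 0"
    using assms(1,3) cnj_u_mult_x unfolding on_\<Gamma>_iff circle_form_def \<kappa>_def by algebra
  hence "\<sigma> * z + u * v = \<kappa> * t" using assms(2) by simp
  thus ?thesis using \<kappa>_nonzero by (simp add: projection_def)
qed

lemma projection_p: "projection p = 1"
proof -
  have "\<sigma> * p + u * v = \<kappa>" unfolding \<kappa>_def \<sigma>_def uvw_expand by algebra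
  thus ?thesis using \<kappa>_nonzero by (simp add: projection_def)
qed

lemma projection_eq_iff: "projection z = projection t \<longleftrightarrow> z = t"
  using \<sigma>_nonzero \<kappa>_nonzero by (simp add: projection_def)

lemma tangent_form_projection: "tangent_form (projection z)
    = \<sigma> * z + u * v - \<kappa> * q + s3 * (\<sigma> * cnj z + cnj u * cnj v - cnj \<kappa> * cnj q)"
proof -
  have "\<kappa> * (projection z - q) = \<sigma> * z + u * v - \<kappa> * q"
    using \<kappa>_nonzero by (simp add: projection_def right_diff_distrib)
  moreover from arg_cong[OF this, of cnj]
  have "cnj \<kappa> * cnj (projection z - q) = \<sigma> * cnj z + cnj u * cnj v - cnj \<kappa> * cnj q"
    by (simp only: complex_cnj_mult complex_cnj_add complex_cnj_diff cnj_\<sigma>)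
  ultimately show ?thesis by (simp add: tangent_form_def mult.assoc)
qed

lemma circumconic_PX_pencil:
  assumes "circumconic K" "on_conic K p" "on_conic K x"
  shows "\<sigma> * conic_form K z = quad_coeff K
    * ((z + x * cnj z - 1 - x) * tangent_form (projection z)
      - (s3 * cnj v + x * v) * circle_form z)"
proof -
  define \<alpha> where "\<alpha> = quad_coeff K"
  have cnj_quad: "cnj \<alpha> = x * s3 * \<alpha>"
    unfolding \<alpha>_def by (rule cnj_quad_coeff_circumconic[OF assms(1,3) x_unit x_not_vertex])
  hence "of_real (norm_coeff K) = \<alpha> * (s3 * cnj q + x * q)"
    using norm_coeff_circumconic[OF assms(1,2) p_off_circle isogonal_eq] s3_unit
    unfolding \<alpha>_def by algebra
  moreover have "s3 * cnj (vertex_form z) = s3 * (cnj z)^2 - s2 * cnj z + s1 - z"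
    using s2_eq cnj_s2 s3_unit unfolding cnj_vertex_form by algebra
  ultimately have "conic_form K z = \<alpha> * ((s3 * cnj q + x * q) * (z * cnj z - 1)
      + vertex_form z + x * (s3 * (cnj z)^2 - s2 * cnj z + s1 - z))"
    using circumconic_form[OF assms(1), of z] cnj_quad unfolding \<alpha>_def by algebra
  moreover have "\<sigma> * ((s3 * cnj q + x * q) * (z * cnj z - 1)
      + vertex_form z + x * (s3 * (cnj z)^2 - s2 * cnj z + s1 - z))
    = (z + x * cnj z - 1 - x) * tangent_form (projection z)
      - (s3 * cnj v + x * v) * circle_form z"
    using s3_mult_cnj_w cnj_u_mult_x unfolding tangent_form_projection cnj_\<kappa>
    unfolding vertex_form_def circle_form_def \<kappa>_def \<sigma>_def s2_isogonal[OF isogonal_eq] isogonal_eq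
      uvw_expand by algebra
  ultimately show ?thesis unfolding \<alpha>_def by algebra
qed

lemma tangent_form_second_intersection:
  assumes K: "is_conic K" "circumconic K" "on_conic K p" "on_conic K x"
    and Z: "on_conic \<Gamma> Z" "on_conic K Z" "Z \<notin> {p, x}"
    and z: "on_conic \<Omega> z" "collinear {x, Z, z}" "z \<noteq> x"
  shows "tangent_form z = 0"
proof -
  have chord: "Z + x * z * cnj Z = x + z"
    using z x_unit collinear_unit_chord_iff[of x z Z]
    by (simp add: insert_commute on_circumcircle_iff)
  have projection: "projection Z = z"
    using projection_\<Gamma>[OF Z(1) _ chord] Z(3) by simp
  have off_line: "Z + x * cnj Z - 1 - x \<noteq> 0"
  proof
    assume "Z + x * cnj Z - 1 - x = 0"
    hence "(Z - x) * (z - 1) = 0" using chord by algebra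
    hence "projection Z = projection p" using Z(3) projection projection_p by simp
    thus False using Z(3) projection_eq_iff by simp
  qed
  have "circle_form Z = 0" "conic_form K Z = 0"
    using Z(1,2) on_\<Gamma>_iff on_conic_iff_form by simp_all
  hence "quad_coeff K * (Z + x * cnj Z - 1 - x) * tangent_form z = 0"
    using circumconic_PX_pencil[OF K(2-4), of Z] unfolding projection by simp
  thus ?thesis
    using off_line quad_coeff_circumconic_nonzero[OF K(1-3) p_off_circle isogonal_eq] by simp
qed

lemma normalized_chord_tangent:
  assumes K: "is_conic K" "on_conic K a" "on_conic K b" "on_conic K c" "on_conic K p" "on_conic K x"
    and Z1: "on_conic \<Gamma> Z1" "on_conic K Z1" "Z1 \<notin> {p, x}"
    and Z2: "on_conic \<Gamma> Z2" "on_conic K Z2" "Z2 \<notin> {p, x}"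
    and z1: "on_conic \<Omega> z1" "collinear {x, Z1, z1}" "z1 \<noteq> x"
    and z2: "on_conic \<Omega> z2" "collinear {x, Z2, z2}" "z2 \<noteq> x"
    and distinct: "z1 \<noteq> z2"
  shows "line_tangent_at z1 z2 Q q"
proof (rule line_tangent_atI)
  show "conic_grad Q q \<noteq> 0"
    using conic_grad_Q quad_coeff_Q_nonzero \<kappa>_nonzero by auto
  have "circumconic K" using K by (simp add: circumconic_def)
  thus "Re (cnj (conic_grad Q q) * (z1 - q)) = 0" "Re (cnj (conic_grad Q q) * (z2 - q)) = 0"
    unfolding perpendicular_conic_grad_Q_iff
    using tangent_form_second_intersection K(1,5,6) Z1 z1 Z2 z2 by blast+
qed (rule Q_conic(6) distinct)+

end

context isogonal_configuration
begin

sublocale complex_frame "circle_center \<Omega>" "D - circle_center \<Omega>"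
  using circle_iff_dist_center(1)[OF circumcircle(1) D_on(1)] by unfold_locales simp

lemma normalized_configuration_coord:
  "normalized_configuration (coord A) (coord B) (coord C) (coord P) (coord P') (coord X) (coord Y)
     (conic_coord \<Omega>) (conic_coord Q) (conic_coord \<Gamma>)"
proof -
  have D: "coord D = 1" using unit_nonzero by (simp add: coord_def)
  have "isogonal_configuration (coord A) (coord B) (coord C) (coord P) (coord P') (coord D)
      (coord X) (coord Y) (conic_coord \<Omega>) (conic_coord Q) (conic_coord \<Gamma>)"
    using isogonal_configuration_axioms by (simp add: isogonal_configuration_def)
  moreover have "on_conic (conic_coord \<Omega>) z \<longleftrightarrow> z * cnj z = 1" for z
  proof -
    obtain z' where z: "z = coord z'" by (rule coordE)
    have "on_conic \<Omega> z' \<longleftrightarrow> cmod z = 1"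
      using circle_iff_dist_center[OF circumcircle(1) D_on(1)]
      by (simp add: z coord_def norm_divide eq_commute[of "cmod (D - _)"])
    also have "\<dots> \<longleftrightarrow> z * cnj z = 1"
      unfolding complex_norm_square[symmetric] of_real_eq_1_iff by (simp add: abs_square_eq_1)
    finally show ?thesis by (simp add: z)
  qed
  ultimately show ?thesis
    unfolding D by (simp add: normalized_configuration_def normalized_configuration_axioms_def)
qed

lemma double_contact:
  assumes "on_conic \<Gamma> Z" "collinear {P, P', Z}" "unique_conic5 A B C P Z"
    and "is_conic K" "on_conic K A" "on_conic K B" "on_conic K C" "on_conic K P" "on_conic K Z"
  shows "curves_tangent_at \<Gamma> K P" "curves_tangent_at \<Gamma> K Z"
  using normalized_configuration.normalized_double_contact[OF normalized_configuration_coord,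
      of "coord Z" "conic_coord K"] assms unique_conic5_coord[OF assms(3)] by simp_all

lemma chord_tangent:
  assumes "is_conic K" "on_conic K A" "on_conic K B" "on_conic K C" "on_conic K P" "on_conic K X"
    and "on_conic \<Gamma> Z1" "on_conic K Z1" "Z1 \<notin> {P, X}"
    and "on_conic \<Gamma> Z2" "on_conic K Z2" "Z2 \<notin> {P, X}"
    and "on_conic \<Omega> Z1'" "collinear {X, Z1, Z1'}" "Z1' \<noteq> X"
    and "on_conic \<Omega> Z2'" "collinear {X, Z2, Z2'}" "Z2' \<noteq> X"
    and "Z1' \<noteq> Z2'"
  shows "line_tangent_at Z1' Z2' Q P'"
  using normalized_configuration.normalized_chord_tangent[OF normalized_configuration_coord,
      of "conic_coord K" "coord Z1" "coord Z2" "coord Z1'" "coord Z2'"] assms by simp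

end

theorem theorem1p2:
  fixes A B C P P' D X Y Z :: complex and \<Omega> Q \<Gamma> :: conic
  assumes tri: "\<not> collinear {A, B, C}"
    and Om: "is_circle \<Omega>" "on_conic \<Omega> A" "on_conic \<Omega> B" "on_conic \<Omega> C"
    and Pgen: "\<not> collinear {A, B, P}" "\<not> collinear {B, C, P}" "\<not> collinear {C, A, P}"
              "\<not> on_conic \<Omega> P"
    and iso: "isogonal_conj A B C P P'" and PP': "P \<noteq> P'"
    and Qc: "unique_conic5 A B C P P'" "is_conic Q"
            "on_conic Q A" "on_conic Q B" "on_conic Q C" "on_conic Q P" "on_conic Q P'"
    and Dd: "on_conic \<Omega> D" "on_conic Q D" "D \<notin> {A, B, C}"
    and Xd: "on_conic \<Omega> X" "collinear {D, P, X}" "X \<noteq> D"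
    and Yd: "on_conic \<Omega> Y" "collinear {D, P', Y}" "Y \<noteq> D"
    and Gc: "\<not> collinear {P, X, Y}" "is_circle \<Gamma>"
            "on_conic \<Gamma> P" "on_conic \<Gamma> X" "on_conic \<Gamma> Y"
    and Zd: "on_conic \<Gamma> Z" "collinear {P, P', Z}" "Z \<noteq> P"
  shows
    "(unique_conic5 A B C P Z \<longrightarrow>
       (\<forall>K. is_conic K \<and> on_conic K A \<and> on_conic K B \<and> on_conic K C \<and> on_conic K P \<and> on_conic K Z
            \<longrightarrow> curves_tangent_at \<Gamma> K P \<and> curves_tangent_at \<Gamma> K Z))
     \<and>
     (\<forall>K Z1 Z2 Z1' Z2'.
        unique_conic5 A B C P X \<and> is_conic K \<and>
        on_conic K A \<and> on_conic K B \<and> on_conic K C \<and> on_conic K P \<and> on_conic K X \<and>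
        on_conic \<Gamma> Z1 \<and> on_conic K Z1 \<and> on_conic \<Gamma> Z2 \<and> on_conic K Z2 \<and>
        Z1 \<noteq> Z2 \<and> Z1 \<notin> {P, X} \<and> Z2 \<notin> {P, X} \<and>
        on_conic \<Omega> Z1' \<and> collinear {X, Z1, Z1'} \<and> Z1' \<noteq> X \<and>
        on_conic \<Omega> Z2' \<and> collinear {X, Z2, Z2'} \<and> Z2' \<noteq> X \<and>
        Z1' \<noteq> Z2'
        \<longrightarrow> line_tangent_at Z1' Z2' Q P')"
proof -
  have "X \<noteq> Y" using Gc(1) by auto
  with assms interpret isogonal_configuration A B C P P' D X Y \<Omega> Q \<Gamma>
    by unfold_locales
  show ?thesis
    by (intro conjI allI impI; elim conjE)
       (rule double_contact[OF Zd(1,2)] chord_tangent; assumption)+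
qed

end
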